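(* Let $k$ be a positive integer. Let $G=(V,E,\partial)$ be a finite undirected graph with $V$ the disjoint union of $\{v_1,v_2,v_3,v_4\}$ (four distinct vertices) and a (possibly empty) set $Y$, such that every vertex $y\in Y$ has even degree in $G$. Suppose that after the deletion of any $k-1$ or fewer edges from $G$, the four vertices $v_1,v_2,v_3,v_4$ can be split into two disjoint pairs $\{v_a,v_b\}$ and $\{v_c,v_d\}$ such that there exist two paths $P_1$ between $v_a$ and $v_b$ and $P_2$ between $v_c$ and $v_d$ having no common edges. Then the four vertices can be split $k$ times into two disjoint pairs $\{v_{a(j)},v_{b(j)}\}$ and $\{v_{c(j)},v_{d(j)}\}$, $j=1,\ldots,k$, such that the two vertices in each of these $2k$ pairs can be connected by a path in $G$ and no two of these $2k$ paths have a common edge.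
   Context: A graph $G=(V,E,\partial)$ consists of a finite nonempty vertex set $V$, a finite edge set $E$, and a map $\partial$ assigning to each edge a set of exactly two distinct vertices (parallel edges allowed, no loops). The degree of a vertex $v$ is the number of edges $e$ with $v\in\partial(e)$. A path between vertices $u$ and $v$ is an alternating sequence $(w_0,e_1,w_1,\ldots,e_t,w_t)$ of vertices and edges with $\{w_0,w_t\}=\{u,v\}$ as endpoints, $\partial(e_i)=\{w_{i-1},w_i\}$ for all $i$, and $e_i\ne e_j$ for $i\ne j$ (vertices may repeat). Deleting edges means removing them from $E$ (the vertex set is unchanged). *)

theory Defs
  imports Main
begin

record ('v, 'e) mgraph =
  verts :: "'v set"
  edges :: "'e set"
  ends :: "'e \<Rightarrow> 'v set"

locale multigraph =
  fixes G :: "('v, 'e) mgraph"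
  assumes finite_verts: "finite (verts G)"
    and verts_nonempty: "verts G \<noteq> {}"
    and finite_edges: "finite (edges G)"
    and ends_subset: "e \<in> edges G \<Longrightarrow> ends G e \<subseteq> verts G"
    and card_ends: "e \<in> edges G \<Longrightarrow> card (ends G e) = 2"

definition degree :: "('v, 'e) mgraph \<Rightarrow> 'v \<Rightarrow> nat" where
  "degree G v = card {e \<in> edges G. v \<in> ends G e}"

definition delete_edges :: "('v, 'e) mgraph \<Rightarrow> 'e set \<Rightarrow> ('v, 'e) mgraph" where
  "delete_edges G F = G\<lparr>edges := edges G - F\<rparr>"

text \<open>The alternating sequence \<open>(w\<^sub>0, e\<^sub>1, w\<^sub>1, \<dots>, e\<^sub>t, w\<^sub>t)\<close> is encoded as the pair of lists
  \<open>([w\<^sub>0, \<dots>, w\<^sub>t], [e\<^sub>1, \<dots>, e\<^sub>t])\<close>. Edges are distinct, vertices may repeat.\<close>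

type_synonym ('v, 'e) altseq = "'v list \<times> 'e list"

definition path_edges :: "('v, 'e) altseq \<Rightarrow> 'e set" where
  "path_edges P = set (snd P)"

definition path_between :: "('v, 'e) mgraph \<Rightarrow> 'v \<Rightarrow> 'v \<Rightarrow> ('v, 'e) altseq \<Rightarrow> bool" where
  "path_between G u v P \<longleftrightarrow> (case P of (ws, es) \<Rightarrow>
     length ws = Suc (length es) \<and>
     set ws \<subseteq> verts G \<and> set es \<subseteq> edges G \<and>
     {ws ! 0, ws ! length es} = {u, v} \<and>
     (\<forall>i < length es. ends G (es ! i) = {ws ! i, ws ! Suc i}) \<and>
     distinct es)"

text \<open>The four elements of \<open>S\<close> are split into the disjoint pairs \<open>{a, b}\<close> and \<open>{c, d}\<close>.\<close>

definition splits_into_pairs :: "'v set \<Rightarrow> 'v \<Rightarrow> 'v \<Rightarrow> 'v \<Rightarrow> 'v \<Rightarrow> bool" where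
  "splits_into_pairs S a b c d \<longleftrightarrow> distinct [a, b, c, d] \<and> {a, b} \<union> {c, d} = S"

end

theory Submission
  imports Defs "HOL-Library.Disjoint_Sets"
begin

text \<open>Write \<open>T\<close> for the set of the four terminals. A pair of edge-disjoint paths that splits \<open>T\<close>
  into two pairs amounts to a \<open>T\<close>-join, i.e. an edge set whose odd-degree vertices are exactly
  \<open>T\<close>. The hypothesis forces every cut separating one terminal from the three others to have at
  least \<open>k\<close> edges, and the claim is that \<open>k\<close> disjoint \<open>T\<close>-joins exist.

  By the method of Lovasz and Cherkassky (splitting off pairs of edges at non-terminal vertices) one
  finds disjoint edge sets, each with exactly two odd vertices, both terminals, such that the terminal
  \<open>t\<close> occurs \<open>n t\<close> times, where \<open>n t \<in> {k, k + 1}\<close> has the parity of the degree of \<open>t\<close>.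
  The number of terminals with \<open>n t = k + 1\<close> is even; if it is two, counting shows that some
  member joins those two, and it is dropped. Once all multiplicities agree, pairs and complementary
  pairs are equally frequent, and matching them gives the \<open>T\<close>-joins.\<close>

section \<open>Degrees, edge cuts and odd-degree vertices\<close>

text \<open>Edge set and end map are separate parameters because splitting off changes both: one
  edge is removed and another is rerouted by updating \<open>d\<close>.\<close>

definition deg :: "'e set \<Rightarrow> ('e \<Rightarrow> 'v set) \<Rightarrow> 'v \<Rightarrow> nat" where
  "deg E d v = card {e \<in> E. v \<in> d e}"

definition cut :: "'e set \<Rightarrow> ('e \<Rightarrow> 'v set) \<Rightarrow> 'v set \<Rightarrow> 'e set" where
  "cut E d X = {e \<in> E. d e \<inter> X \<noteq> {} \<and> \<not> d e \<subseteq> X}"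

definition odd_verts :: "('e \<Rightarrow> 'v set) \<Rightarrow> 'e set \<Rightarrow> 'v set" where
  "odd_verts d P = {v. odd (deg P d v)}"

text \<open>The members \<open>f i\<close> stand in for paths between two terminals. Recording only
  the two odd vertices makes it easy to undo a split: one edge is added to a set, and no vertex
  sequence has to be rebuilt.\<close>

definition pair_family ::
  "'e set \<Rightarrow> ('e \<Rightarrow> 'v set) \<Rightarrow> 'v set \<Rightarrow> ('v \<Rightarrow> nat) \<Rightarrow> 'i set \<Rightarrow> ('i \<Rightarrow> 'e set) \<Rightarrow> bool" where
  "pair_family E d T n I f \<longleftrightarrow> finite I \<and> disjoint_family_on f I \<and>
     (\<forall>i\<in>I. f i \<subseteq> E \<and> odd_verts d (f i) \<subseteq> T \<and> card (odd_verts d (f i)) = 2) \<and>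
     (\<forall>t\<in>T. card {i \<in> I. t \<in> odd_verts d (f i)} = n t)"

lemma finite_cut [simp]: "finite E \<Longrightarrow> finite (cut E d X)"
  by (simp add: cut_def)

lemma deg_Un:
  assumes "finite A" "finite B" "A \<inter> B = {}"
  shows "deg (A \<union> B) d v = deg A d v + deg B d v"
proof -
  have "{e \<in> A \<union> B. v \<in> d e} = {e \<in> A. v \<in> d e} \<union> {e \<in> B. v \<in> d e}" by auto
  then show ?thesis
    unfolding deg_def using assms by (simp add: card_Un_disjoint disjoint_iff)
qed

lemma deg_insert:
  assumes "finite A" "e \<notin> A"
  shows "deg (insert e A) d v = deg A d v + (if v \<in> d e then 1 else 0)"
proof -
  have "{x \<in> insert e A. v \<in> d x} = (if v \<in> d e then insert e {x \<in> A. v \<in> d x} else {x \<in> A. v \<in> d x})"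
    by auto
  then show ?thesis unfolding deg_def using assms by simp
qed

lemma deg_empty [simp]: "deg {} d v = 0"
  by (simp add: deg_def)

lemma deg_cong: "(\<And>e. e \<in> A \<Longrightarrow> d e = d' e) \<Longrightarrow> deg A d v = deg A d' v"
  unfolding deg_def by (metis (mono_tags, lifting) Collect_cong)

lemma deg_pos_iff: "finite A \<Longrightarrow> 0 < deg A d v \<longleftrightarrow> (\<exists>e\<in>A. v \<in> d e)"
  by (auto simp: deg_def card_gt_0_iff)

lemma odd_verts_Un:
  assumes "finite A" "finite B" "A \<inter> B = {}"
  shows "odd_verts d (A \<union> B) = (odd_verts d A - odd_verts d B) \<union> (odd_verts d B - odd_verts d A)"
  using deg_Un[OF assms, of d] by (auto simp: odd_verts_def)

lemma odd_verts_insert: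
  assumes "finite A" "e \<notin> A"
  shows "odd_verts d (insert e A) = (odd_verts d A - d e) \<union> (d e - odd_verts d A)"
  using deg_insert[OF assms, of d] by (auto simp: odd_verts_def)

lemma odd_verts_empty [simp]: "odd_verts d {} = {}"
  by (simp add: odd_verts_def)

section \<open>Cut sizes: parity and uncrossing\<close>

lemma cut_singleton:
  assumes "\<And>e. e \<in> E \<Longrightarrow> card (d e) = 2"
  shows "card (cut E d {v}) = deg E d v"
proof -
  have "cut E d {v} = {e \<in> E. v \<in> d e}"
  proof -
    have "\<not> d e \<subseteq> {v}" if "e \<in> E" for e
      using assms[OF that] card_mono[of "{v}" "d e"] by auto
    then show ?thesis by (auto simp: cut_def)
  qed
  then show ?thesis by (simp add: deg_def)
qed

lemma card_cut_sum:
  assumes "finite E"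
  shows "card (cut E d X) = (\<Sum>e\<in>E. if d e \<inter> X \<noteq> {} \<and> \<not> d e \<subseteq> X then 1 else 0)"
  using assms by (simp add: cut_def sum.If_cases Int_def)

lemma sum_deg:
  assumes "finite E" "finite X"
  shows "(\<Sum>v\<in>X. deg E d v) = (\<Sum>e\<in>E. card (d e \<inter> X))"
proof -
  have "(\<Sum>v\<in>X. deg E d v) = (\<Sum>v\<in>X. \<Sum>e\<in>E. if v \<in> d e then 1 else 0)"
    using assms by (simp add: deg_def sum.If_cases Int_def)
  also have "\<dots> = (\<Sum>e\<in>E. \<Sum>v\<in>X. if v \<in> d e then 1 else 0)" by (rule sum.swap)
  also have "\<dots> = (\<Sum>e\<in>E. card (d e \<inter> X))"
    using assms by (simp add: sum.If_cases Int_def conj_commute)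
  finally show ?thesis .
qed

text \<open>Every edge contributes an even amount: with both ends in \<open>X\<close> it counts
  twice among the degrees, with one end in \<open>X\<close> once there and once in the cut.\<close>

lemma handshake:
  assumes "finite E" "finite X" "\<And>e. e \<in> E \<Longrightarrow> card (d e) = 2"
  shows "even ((\<Sum>v\<in>X. deg E d v) + card (cut E d X))"
proof -
  have "even (card (d e \<inter> X) + (if d e \<inter> X \<noteq> {} \<and> \<not> d e \<subseteq> X then 1 else 0))" if e: "e \<in> E" for e
  proof -
    obtain u w where "d e = {u, w}" "u \<noteq> w" using assms(3)[OF e] by (meson card_2_iff)
    then show ?thesis by (cases "u \<in> X"; cases "w \<in> X") auto
  qed
  then have "even (\<Sum>e\<in>E. card (d e \<inter> X) + (if d e \<inter> X \<noteq> {} \<and> \<not> d e \<subseteq> X then 1 else 0))"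
    by (rule dvd_sum)
  then show ?thesis
    by (simp only: sum_deg[OF assms(1,2)] card_cut_sum[OF assms(1)] sum.distrib)
qed

text \<open>In \<open>handshake\<close> the only vertex of \<open>X\<close> that may have odd degree
  is \<open>t\<close>. This is what later turns a slack of at least 1 in the cut condition into a
  slack of at least 2.\<close>

lemma cut_parity:
  assumes "finite E" "finite X" "\<And>e. e \<in> E \<Longrightarrow> card (d e) = 2"
    and "X \<inter> T = {t}" "\<And>v. v \<in> X - T \<Longrightarrow> even (deg E d v)"
  shows "even (card (cut E d X)) \<longleftrightarrow> even (deg E d t)"
proof -
  have t: "t \<in> X" using assms(4) by auto
  have "even (\<Sum>v\<in>X - {t}. deg E d v)"
  proof (rule dvd_sum)
    fix v assume "v \<in> X - {t}"
    then have "v \<in> X - T" using assms(4) by blast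
    then show "even (deg E d v)" by (rule assms(5))
  qed
  moreover have "(\<Sum>v\<in>X. deg E d v) = deg E d t + (\<Sum>v\<in>X - {t}. deg E d v)"
    using assms(2) t by (rule sum.remove)
  ultimately have "even (deg E d t + card (cut E d X)) \<longleftrightarrow> True"
    using handshake[of E X d, OF assms(1-3)] by simp
  then show ?thesis by auto
qed

text \<open>The inequality already holds edge by edge, by cases on the position of the two
  ends.\<close>

lemma cut_submodular:
  assumes "finite E" "\<And>e. e \<in> E \<Longrightarrow> card (d e) = 2"
  shows "card (cut E d (A \<inter> B)) + card (cut E d (A \<union> B)) \<le> card (cut E d A) + card (cut E d B)"
  unfolding card_cut_sum[OF assms(1)] sum.distrib[symmetric]
proof (rule sum_mono)
  fix e assume "e \<in> E"
  then obtain u w where "d e = {u, w}" "u \<noteq> w" using assms(2) by (meson card_2_iff)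
  then show "(if d e \<inter> (A \<inter> B) \<noteq> {} \<and> \<not> d e \<subseteq> A \<inter> B then 1 else 0) +
      (if d e \<inter> (A \<union> B) \<noteq> {} \<and> \<not> d e \<subseteq> A \<union> B then 1 else 0)
      \<le> (if d e \<inter> A \<noteq> {} \<and> \<not> d e \<subseteq> A then 1 else 0) +
        (if d e \<inter> B \<noteq> {} \<and> \<not> d e \<subseteq> B then 1 else (0::nat))"
    by (cases "u \<in> A"; cases "w \<in> A"; cases "u \<in> B"; cases "w \<in> B") auto
qed

lemma cut_Compl: "cut E d (- X) = cut E d X"
  by (auto simp: cut_def)

text \<open>Submodularity for \<open>A\<close> and the complement of \<open>B\<close>, since a set
  and its complement have the same cut.\<close>

lemma cut_posimodular:
  assumes "finite E" "\<And>e. e \<in> E \<Longrightarrow> card (d e) = 2"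
  shows "card (cut E d (A - B)) + card (cut E d (B - A)) \<le> card (cut E d A) + card (cut E d B)"
proof -
  have "A \<inter> - B = A - B" "A \<union> - B = - (B - A)" by auto
  then show ?thesis using cut_submodular[of E d A "- B", OF assms] by (simp only: cut_Compl)
qed

text \<open>The edge \<open>e\<close> from \<open>A \<inter> B\<close> to the outside of
  \<open>A \<union> B\<close> lies in the cuts of \<open>A\<close> and \<open>B\<close> but in
  neither cut on the left. Delete it and apply the weak inequality.\<close>

lemma cut_posimodular_strict:
  assumes "finite E" "\<And>e. e \<in> E \<Longrightarrow> card (d e) = 2"
    and e: "e \<in> E" "d e = {v, x}" "v \<in> A \<inter> B" "x \<notin> A \<union> B"
  shows "card (cut E d (A - B)) + card (cut E d (B - A)) < card (cut E d A) + card (cut E d B)"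
proof -
  have rest: "cut (E - {e}) d X = cut E d X - {e}" for X by (auto simp: cut_def)
  have "e \<in> cut E d A" "e \<notin> cut E d (A - B)" "e \<notin> cut E d (B - A)"
    using e by (simp_all add: cut_def)
  then show ?thesis
    using cut_posimodular[of "E - {e}" d A B] assms(1,2) card_Diff1_less[of "cut E d A" e]
      card_Diff1_le[of "cut E d B" e]
    by (simp add: rest del: card_Diff_insert)
qed

section \<open>From T-joins to edge-disjoint paths\<close>

text \<open>Walk from \<open>a\<close> along any edge of \<open>F\<close> to \<open>c\<close>. If
  \<open>c\<close> is odd, stop. Otherwise deleting the edge makes \<open>c\<close> odd and
  \<open>a\<close> even in the rest, so the walk continues from \<open>c\<close> there and ends at a
  vertex other than \<open>a\<close>. The conjunct \<open>ws ! 0 = a\<close> fixes the direction,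
  which \<open>path_between\<close> leaves open, so that an edge can be prepended.\<close>

lemma odd_vertex_path:
  assumes "multigraph G" "finite F" "F \<subseteq> edges G" "a \<in> odd_verts (ends G) F"
  shows "\<exists>b ws es. b \<noteq> a \<and> b \<in> odd_verts (ends G) F \<and> path_between G a b (ws, es) \<and>
      ws ! 0 = a \<and> set es \<subseteq> F \<and> odd_verts (ends G) (set es) = {a, b}"
  using assms(2-)
proof (induction "card F" arbitrary: F a rule: less_induct)
  case less
  interpret multigraph G by fact
  obtain e where e: "e \<in> F" "a \<in> ends G e"
    using less.prems(1,3) deg_pos_iff[of F "ends G" a] by (auto simp: odd_verts_def odd_pos)
  have eG: "e \<in> edges G" using e less.prems by auto
  obtain c where c: "ends G e = {a, c}" "a \<noteq> c"
    using card_ends[OF eG] e by (auto simp: card_2_iff doubleton_eq_iff)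
  define F' where "F' = F - {e}"
  have F': "finite F'" "e \<notin> F'" "F = insert e F'" "F' \<subseteq> edges G" "card F' < card F"
    using less.prems e card_Diff1_less[of F e] by (auto simp: F'_def simp del: card_Diff_insert card_Diff_singleton)
  have O: "odd_verts (ends G) F = (odd_verts (ends G) F' - {a, c}) \<union> ({a, c} - odd_verts (ends G) F')"
    using odd_verts_insert[OF F'(1,2), of "ends G"] F'(3) c by simp
  have ac: "{a, c} \<subseteq> verts G" using ends_subset[OF eG] c by simp
  have Oe: "odd_verts (ends G) {e} = {a, c}" using odd_verts_insert[of "{}" e "ends G"] c by simp
  show ?case
  proof (cases "c \<in> odd_verts (ends G) F")
    case True
    have "path_between G a c ([a, c], [e])"
      using ac eG c by (simp add: path_between_def)
    then show ?thesis using True c e Oe by (intro exI[of _ c] exI[of _ "[a,c]"] exI[of _ "[e]"]) auto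
  next
    case False
    then have "c \<in> odd_verts (ends G) F'" using O by auto
    from less.hyps[OF F'(5,1,4) this] obtain b ws es where b: "b \<noteq> c" "b \<in> odd_verts (ends G) F'"
      "path_between G c b (ws, es)" "ws ! 0 = c" "set es \<subseteq> F'" "odd_verts (ends G) (set es) = {c, b}"
      by blast
    have "a \<notin> odd_verts (ends G) F'" using O less.prems by auto
    then have ba: "b \<noteq> a" using b by auto
    have "ws ! length es = b" using b by (auto simp: path_between_def doubleton_eq_iff)
    then have p: "path_between G a b (a # ws, e # es)"
      using b(3,4,5) ac c eG F'(2) by (auto simp: path_between_def nth_Cons split: nat.split)
    have "e \<notin> set es" using b F' by auto
    then have "odd_verts (ends G) (set (e # es)) = {a, b}"
      using odd_verts_insert[of "set es" e "ends G"] b c ba by auto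
    then show ?thesis using p ba b O F'(3)
      by (intro exI[of _ b] exI[of _ "a # ws"] exI[of _ "e # es"]) auto
  qed
qed

text \<open>Removing the first path changes parity only at its two ends, so the remaining edges have
  exactly the other two terminals as odd vertices and contain a path between them.\<close>

lemma tjoin_two_paths:
  assumes "multigraph G" "finite F" "F \<subseteq> edges G" "odd_verts (ends G) F = T" "card T = 4"
  shows "\<exists>a b c d P Q. splits_into_pairs T a b c d \<and> path_between G a b P \<and> path_between G c d Q
     \<and> path_edges P \<subseteq> F \<and> path_edges Q \<subseteq> F \<and> path_edges P \<inter> path_edges Q = {}"
proof -
  obtain a where a: "a \<in> T" using assms(5) by fastforce
  obtain b ws es where b: "b \<noteq> a" "b \<in> T" "path_between G a b (ws, es)" "set es \<subseteq> F"
    "odd_verts (ends G) (set es) = {a, b}"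
    using odd_vertex_path[OF assms(1-3)] a assms(4) by blast
  define F' where "F' = F - set es"
  have F': "finite F'" "F' \<subseteq> edges G" using assms by (auto simp: F'_def)
  have "F = F' \<union> set es" "F' \<inter> set es = {}" using b by (auto simp: F'_def)
  then have "odd_verts (ends G) F' = T - {a, b}"
    using odd_verts_Un[OF F'(1), of "set es" "ends G"] b a assms(4) by auto
  moreover have "card (T - {a, b}) = 2"
    using assms(5) a b by (simp add: card_Diff_subset)
  ultimately obtain c d where cd: "odd_verts (ends G) F' = {c, d}" "c \<noteq> d" "T - {a, b} = {c, d}"
    by (metis card_2_iff)
  then obtain d' ws' es' where d: "d' \<noteq> c" "d' \<in> {c, d}" "path_between G c d' (ws', es')" "set es' \<subseteq> F'"
    using odd_vertex_path[OF assms(1) F', of c] by blast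
  have "splits_into_pairs T a b c d" using cd a b by (auto simp: splits_into_pairs_def)
  moreover have "path_between G c d (ws', es')" using d(1-3) by auto
  moreover have "path_edges (ws, es) \<subseteq> F" "path_edges (ws', es') \<subseteq> F"
    "path_edges (ws, es) \<inter> path_edges (ws', es') = {}"
    using b(4) d(4) by (auto simp: path_edges_def F'_def)
  ultimately show ?thesis using b(3) by blast
qed

section \<open>Families of terminal pairs and their assembly into T-joins\<close>

lemma pair_family_remove:
  assumes "pair_family E d T n I f" "i \<in> I" "odd_verts d (f i) = {a, b}"
  shows "pair_family E d T (\<lambda>t. if t \<in> {a, b} then n t - 1 else n t) (I - {i}) f"
proof -
  have "{j \<in> I - {i}. t \<in> odd_verts d (f j)} = {j \<in> I. t \<in> odd_verts d (f j)} - {i}" for t by auto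
  then show ?thesis
    using assms unfolding pair_family_def
    by (auto simp: card_Diff_singleton disjoint_family_on_def)
qed

text \<open>If \<open>n\<close> is the number of pairs at each of the four terminals, then the multiplicity of
  \<open>{c, e}\<close> exceeds that of \<open>{a, b}\<close> by half of \<open>n c + n e - n a - n b\<close>.\<close>

lemma pair_family_complementary:
  assumes pf: "pair_family E d {a, b, c, e} n I f" and dist: "distinct [a, b, c, e]"
    and le: "n a + n b \<le> n c + n e"
    and "n a + n b < n c + n e \<or> (\<exists>i\<in>I. odd_verts d (f i) = {a, b})"
  shows "\<exists>j\<in>I. odd_verts d (f j) = {c, e}"
proof (rule ccontr)
  assume no: "\<not> ?thesis"
  let ?O = "\<lambda>i. odd_verts d (f i)"
  have I: "finite I" using pf by (simp add: pair_family_def)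
  have O: "?O i \<subseteq> {a, b, c, e}" "card (?O i) = 2" if "i \<in> I" for i
    using pf that by (auto simp: pair_family_def)
  \<comment> \<open>Double counting of incidences between the members and the two terminals
    \<open>x\<close> and \<open>y\<close>.\<close>
  have cnt: "n x + n y = (\<Sum>i\<in>I. card (?O i \<inter> {x, y}))"
    if "x \<in> {a, b, c, e}" "y \<in> {a, b, c, e}" "x \<noteq> y" for x y
  proof -
    have "n z = (\<Sum>i\<in>I. if z \<in> ?O i then 1 else 0)" if "z \<in> {a, b, c, e}" for z
    proof -
      have "n z = card {i \<in> I. z \<in> ?O i}" using pf that unfolding pair_family_def by metis
      then show ?thesis using I by (simp add: sum.If_cases Int_def)
    qed
    then have "n x + n y = (\<Sum>i\<in>I. (if x \<in> ?O i then 1 else 0) + (if y \<in> ?O i then 1 else 0))"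
      using that by (simp only: sum.distrib)
    also have "\<dots> = (\<Sum>i\<in>I. card (?O i \<inter> {x, y}))"
      by (rule sum.cong) (use that in auto)
    finally show ?thesis .
  qed
  \<comment> \<open>A pair other than \<open>{c, e}\<close> contains at most one of
    \<open>c\<close>, \<open>e\<close>, and therefore at least one of \<open>a\<close>,
    \<open>b\<close>.\<close>
  have le1: "card (?O i \<inter> {c, e}) \<le> card (?O i \<inter> {a, b})" if i: "i \<in> I" for i
  proof -
    obtain x y where xy: "?O i = {x, y}" "x \<noteq> y" using O(2)[OF i] by (meson card_2_iff)
    then have "x \<in> {a, b, c, e}" "y \<in> {a, b, c, e}" "{x, y} \<noteq> {c, e}" using O(1)[OF i] no i by auto
    then have "\<exists>z w. ?O i \<inter> {c, e} \<subseteq> {w} \<and> z \<in> ?O i \<inter> {a, b}" using xy by auto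
    then obtain z w where zw: "?O i \<inter> {c, e} \<subseteq> {w}" "z \<in> ?O i \<inter> {a, b}" by blast
    have "card (?O i \<inter> {c, e}) \<le> card {w}" by (rule card_mono) (use zw in auto)
    also have "\<dots> = card {z}" by simp
    also have "\<dots> \<le> card (?O i \<inter> {a, b})" by (rule card_mono) (use zw in auto)
    finally show ?thesis .
  qed
  have "n c + n e \<le> n a + n b"
    using dist cnt[of c e] cnt[of a b] sum_mono[of I, OF le1] by simp
  \<comment> \<open>A member with pair \<open>{a, b}\<close> contributes 2 on one side and 0 on the
    other, so the sums differ strictly.\<close>
  moreover have "n c + n e < n a + n b" if i: "i \<in> I" "?O i = {a, b}" for i
  proof -
    have "(\<Sum>i\<in>I. card (?O i \<inter> {c, e})) < (\<Sum>i\<in>I. card (?O i \<inter> {a, b}))"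
    proof (rule sum_strict_mono_ex1[OF I])
      show "\<forall>i\<in>I. card (?O i \<inter> {c, e}) \<le> card (?O i \<inter> {a, b})" using le1 by blast
      show "\<exists>i\<in>I. card (?O i \<inter> {c, e}) < card (?O i \<inter> {a, b})"
        using i dist by (intro bexI[of _ i]) auto
    qed
    then show ?thesis using dist cnt[of c e] cnt[of a b] by simp
  qed
  ultimately show False using assms(3,4) by (meson leD order_le_less_trans)
qed

lemma pair_family_cong:
  "pair_family E d T n I f \<Longrightarrow> (\<And>t. t \<in> T \<Longrightarrow> n t = m t) \<Longrightarrow> pair_family E d T m I f"
  by (simp add: pair_family_def)

text \<open>With equal multiplicities, a member with pair \<open>{a, b}\<close> comes with a member
  for the complementary pair, and the disjoint union of the two is a T-join. Removing both lowers
  every multiplicity by one.\<close>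

lemma pair_family_tjoins:
  assumes "pair_family E d T (\<lambda>_. k) I f" "card T = 4" "finite E"
  shows "\<exists>J. (\<forall>j\<in>{1..k}. J j \<subseteq> (\<Union>i\<in>I. f i) \<and> odd_verts d (J j) = T) \<and> disjoint_family_on J {1..k}"
  using assms(1)
proof (induction k arbitrary: I)
  case 0
  then show ?case by (auto simp: disjoint_family_on_def)
next
  case (Suc k)
  note pf = Suc.prems
  obtain a where a: "a \<in> T" using assms(2) by fastforce
  have "card {i \<in> I. a \<in> odd_verts d (f i)} = Suc k" using pf a by (simp add: pair_family_def)
  then obtain i where i: "i \<in> I" "a \<in> odd_verts d (f i)"
    by (metis (mono_tags, lifting) card.empty empty_Collect_eq nat.distinct(1))
  then obtain b where b: "odd_verts d (f i) = {a, b}" "a \<noteq> b"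
    using pf by (auto simp: pair_family_def card_2_iff doubleton_eq_iff dest!: bspec)
  have bT: "b \<in> T" using pf i b by (auto simp: pair_family_def)
  have "card (T - {a, b}) = 2" using assms(2) a b bT by (simp add: card_Diff_subset)
  then obtain c e where ce: "T - {a, b} = {c, e}" "c \<noteq> e" by (meson card_2_iff)
  have T: "T = {a, b, c, e}" "distinct [a, b, c, e]" using ce a b bT by auto
  obtain i' where i': "i' \<in> I" "odd_verts d (f i') = {c, e}"
    using pair_family_complementary[of E d a b c e "\<lambda>_. Suc k" I f] pf T i(1) b(1) by auto
  have ii: "i' \<noteq> i" using b i' T by (auto simp: doubleton_eq_iff)
  have "pair_family E d T (\<lambda>_. k) (I - {i} - {i'}) f"
    by (rule pair_family_cong[OF pair_family_remove[OF pair_family_remove[OF pf i(1) b(1)] _ i'(2)]])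
       (use i' ii T in auto)
  from Suc.IH[OF this] obtain J where
    J: "\<forall>j\<in>{1..k}. J j \<subseteq> (\<Union>i\<in>I - {i} - {i'}. f i) \<and> odd_verts d (J j) = T"
       "disjoint_family_on J {1..k}" by blast
  have df: "disjoint_family_on f I" using pf by (simp add: pair_family_def)
  have fin: "finite (f j)" if "j \<in> I" for j
    using pf that assms(3) by (auto simp: pair_family_def intro: finite_subset)
  have disj: "(f i \<union> f i') \<inter> (\<Union>j\<in>I - {i} - {i'}. f j) = {}"
    using df i(1) i'(1) by (fastforce simp: disjoint_family_on_def)
  have "f i \<inter> f i' = {}" using df i(1) i'(1) ii by (auto simp: disjoint_family_on_def)
  then have odd: "odd_verts d (f i \<union> f i') = T"
    using odd_verts_Un[OF fin[OF i(1)] fin[OF i'(1)], of d] b i' T by auto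
  define J' where "J' = J(Suc k := f i \<union> f i')"
  have disj': "disjoint_family_on J' {1..Suc k}"
  proof -
    have "J j \<inter> (f i \<union> f i') = {}" if "j \<in> {1..k}" for j using J(1) disj that by blast
    then have "disjoint_family_on J' (insert (Suc k) {1..k})"
      using J(2) by (fastforce simp: disjoint_family_on_def J'_def)
    then show ?thesis by (simp add: atLeastAtMostSuc_conv)
  qed
  have "\<forall>j\<in>{1..Suc k}. J' j \<subseteq> (\<Union>i\<in>I. f i) \<and> odd_verts d (J' j) = T"
  proof
    fix j assume j: "j \<in> {1..Suc k}"
    show "J' j \<subseteq> (\<Union>i\<in>I. f i) \<and> odd_verts d (J' j) = T"
    proof (cases "j = Suc k")
      case True
      then show ?thesis using i(1) i'(1) by (auto simp only: J'_def fun_upd_same odd)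
    next
      case False
      then have "j \<in> {1..k}" using j by simp
      then have "J j \<subseteq> (\<Union>i\<in>I. f i) \<and> odd_verts d (J j) = T" using J(1) by blast
      then show ?thesis using False by (simp only: J'_def fun_upd_other not_False_eq_True)
    qed
  qed
  then show ?case using disj' by (intro exI[of _ J'] conjI)
qed

section \<open>Splitting off two edges at a non-terminal\<close>

text \<open>The edges \<open>uv\<close> and \<open>vw\<close> become one edge \<open>uw\<close>,
  which keeps the name \<open>e\<close>, while \<open>f\<close> disappears. A cut shrinks only if it
  has \<open>v\<close> on one side and both \<open>u\<close> and \<open>w\<close> on the
  other.\<close>

lemma cut_split_off:
  assumes "finite E" "e \<in> E" "f \<in> E" "e \<noteq> f" "d e = {u, v}" "d f = {v, w}" "distinct [u, v, w]"
  shows "card (cut E d X) = card (cut (E - {f}) (d(e := {u, w})) X) +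
    (if v \<in> X \<and> u \<notin> X \<and> w \<notin> X \<or> v \<notin> X \<and> u \<in> X \<and> w \<in> X then 2 else 0)"
proof -
  define R where "R = E - {e, f}"
  have R: "finite R" "e \<notin> R" "f \<notin> R" "E = insert e (insert f R)" "E - {f} = insert e R"
    using assms(1-4) by (auto simp: R_def)
  let ?c = "\<lambda>d g. if d g \<inter> X \<noteq> {} \<and> \<not> d g \<subseteq> X then 1 else (0::nat)"
  have 1: "card (cut E d X) = ?c d e + ?c d f + (\<Sum>g\<in>R. ?c d g)"
    using R(1-3) assms(4) by (simp add: card_cut_sum R(4))
  have "(\<Sum>g\<in>R. ?c (d(e := {u, w})) g) = (\<Sum>g\<in>R. ?c d g)"
    by (rule sum.cong) (use R(2) in auto)
  then have 2: "card (cut (E - {f}) (d(e := {u, w})) X)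
      = (if {u, w} \<inter> X \<noteq> {} \<and> \<not> {u, w} \<subseteq> X then 1 else 0) + (\<Sum>g\<in>R. ?c d g)"
    unfolding R(5) using R(1,2) by (simp add: card_cut_sum del: fun_upd_apply) simp
  show ?thesis unfolding 1 2 assms(5,6)
    by (cases "u \<in> X"; cases "v \<in> X"; cases "w \<in> X") auto
qed

text \<open>Undoing a split: a set that uses the new edge \<open>uw\<close> receives
  \<open>uv\<close> and \<open>vw\<close> instead. The vertex \<open>v\<close> is toggled twice, so
  no parity changes.\<close>

lemma odd_verts_split_off:
  assumes "finite P" "f \<notin> P" "e \<noteq> f" "d e = {u, v}" "d f = {v, w}" "distinct [u, v, w]"
  shows "odd_verts d (if e \<in> P then insert f P else P) = odd_verts (d(e := {u, w})) P"
proof (cases "e \<in> P")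
  case False
  then have "deg P d x = deg P (d(e := {u, w})) x" for x by (intro deg_cong) auto
  then show ?thesis using False by (simp add: odd_verts_def)
next
  case True
  define Q where "Q = P - {e}"
  have Q: "finite Q" "e \<notin> Q" "f \<notin> Q" "P = insert e Q" using assms True by (auto simp: Q_def)
  have "odd_verts (d(e := {u, w})) Q = odd_verts d Q"
  proof -
    have "deg Q (d(e := {u, w})) x = deg Q d x" for x using Q(2) by (intro deg_cong) auto
    then show ?thesis by (simp add: odd_verts_def)
  qed
  then have "odd_verts (d(e := {u, w})) P = (odd_verts d Q - {u, w}) \<union> ({u, w} - odd_verts d Q)"
    using odd_verts_insert[OF Q(1,2), of "d(e := {u, w})"] Q(4) by simp
  moreover have "odd_verts d (insert e Q) = (odd_verts d Q - {u, v}) \<union> ({u, v} - odd_verts d Q)"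
    using odd_verts_insert[OF Q(1,2), of d] assms(4) by simp
  moreover have "odd_verts d (insert f (insert e Q))
      = (odd_verts d (insert e Q) - {v, w}) \<union> ({v, w} - odd_verts d (insert e Q))"
    using odd_verts_insert[of "insert e Q" f d] Q assms(3,5) by simp
  ultimately show ?thesis using True assms(6) unfolding Q(4) by auto
qed

text \<open>A split at \<open>v\<close> can only be spoiled by a tight set (a set attaining the bound in
  \<open>cut_ge\<close>). The choice of \<open>w\<close> is dictated by an extremal one: either a smallest tight
  set of another terminal containing \<open>v\<close>, or, if there is none, a largest tight set of \<open>s\<close>
  avoiding \<open>v\<close>; uncrossing excludes all others.\<close>

lemma exists_admissible_split:
  assumes V: "finite V" "T \<subseteq> V"
    and E: "finite E" "\<And>g. g \<in> E \<Longrightarrow> d g \<subseteq> V \<and> card (d g) = 2"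
    and even: "\<And>x. x \<in> V - T \<Longrightarrow> even (deg E d x)"
    and cut_ge: "\<And>X t. X \<subseteq> V \<Longrightarrow> X \<inter> T = {t} \<Longrightarrow> deg E d t \<le> card (cut E d X)"
    and e: "e \<in> E" "d e = {s, v}" "s \<in> T" "v \<in> V - T"
  shows "\<exists>f w. f \<in> E \<and> f \<noteq> e \<and> d f = {v, w} \<and> w \<noteq> s \<and> w \<noteq> v \<and>
    (\<forall>X t. X \<subseteq> V \<longrightarrow> X \<inter> T = {t} \<longrightarrow>
      (v \<in> X \<and> s \<notin> X \<and> w \<notin> X \<or> v \<notin> X \<and> s \<in> X \<and> w \<in> X) \<longrightarrow>
      deg E d t + 2 \<le> card (cut E d X))"
proof -
  define D where "D X = card (cut E d X)" for X
  define tight where "tight t X \<longleftrightarrow> X \<subseteq> V \<and> X \<inter> T = {t} \<and> D X = deg E d t" for t X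
  have c2: "\<And>g. g \<in> E \<Longrightarrow> card (d g) = 2" using E(2) by blast
  have fin: "finite X" if "X \<subseteq> V" for X using V(1) that by (rule rev_finite_subset)
  have ge: "deg E d t \<le> D X" if "X \<subseteq> V" "X \<inter> T = {t}" for X t
    using cut_ge[OF that] by (simp add: D_def)
  \<comment> \<open>By parity the slack is never exactly 1, so a split, which lowers a cut by at
    most 2, can only violate the bound at tight sets.\<close>
  have not_tight: "deg E d t + 2 \<le> D X" if X: "X \<subseteq> V" "X \<inter> T = {t}" "\<not> tight t X" for X t
  proof -
    have "even (D X) \<longleftrightarrow> even (deg E d t)"
      unfolding D_def using cut_parity[of E X d T t, OF E(1) fin[OF X(1)] c2 X(2)] even X(1) by blast
    moreover have "D X \<noteq> deg E d t" using X unfolding tight_def by blast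
    moreover have "D X \<noteq> Suc (deg E d t)" using calculation(1) by auto
    ultimately show ?thesis using ge[OF X(1,2)] by linarith
  qed
  \<comment> \<open>Submodularity squeezes both cuts between the lower bound and equality.\<close>
  have tight_Int_Un: "tight t (A \<inter> B)" "tight t (A \<union> B)" if "tight t A" "tight t B" for t A B
  proof -
    have s: "A \<inter> B \<subseteq> V" "A \<inter> B \<inter> T = {t}" "A \<union> B \<subseteq> V" "(A \<union> B) \<inter> T = {t}"
      using that unfolding tight_def by blast+
    have "D (A \<inter> B) + D (A \<union> B) \<le> D A + D B"
      unfolding D_def by (rule cut_submodular[of E d, OF E(1) c2])
    then have "D (A \<inter> B) = deg E d t" "D (A \<union> B) = deg E d t"
      using ge[OF s(1,2)] ge[OF s(3,4)] that by (simp_all add: tight_def)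
    then show "tight t (A \<inter> B)" "tight t (A \<union> B)" using s by (simp_all add: tight_def)
  qed
  have sv: "s \<noteq> v" "s \<in> V" "v \<in> V" "v \<notin> T" using e V by auto
  have neq: "t \<noteq> s" if "X \<inter> T = {t}" "s \<notin> X" for X t using that by blast
  have eqs: "t = s" if "X \<inter> T = {t}" "s \<in> X" for X t using that e(3) by (metis IntI singletonD)
  have "\<exists>f w. f \<in> E \<and> f \<noteq> e \<and> d f = {v, w} \<and> w \<noteq> s \<and> w \<noteq> v \<and>
    (\<forall>t X. tight t X \<longrightarrow> \<not> (v \<in> X \<and> s \<notin> X \<and> w \<notin> X) \<and> \<not> (v \<notin> X \<and> s \<in> X \<and> w \<in> X))"
  proof (cases "\<exists>t B. t \<noteq> s \<and> tight t B \<and> v \<in> B")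
    case True
    \<comment> \<open>The minimum is taken over all terminals \<open>t\<close> other than
      \<open>s\<close> at once.\<close>
    define Q where "Q = (\<lambda>(t, B). t \<noteq> s \<and> tight t B \<and> v \<in> B)"
    obtain p0 where "Q p0" using True unfolding Q_def by auto
    then obtain p where p: "Q p" "\<And>q. Q q \<Longrightarrow> card (snd p) \<le> card (snd q)"
      using ex_has_least_nat[of Q p0 "\<lambda>q. card (snd q)"] by blast
    obtain t B where tB: "p = (t, B)" by force
    have B: "t \<noteq> s" "tight t B" "v \<in> B" using p(1) tB by (auto simp: Q_def)
    have min: "card B \<le> card B'" if "t' \<noteq> s" "tight t' B'" "v \<in> B'" for t' B'
      using p(2)[of "(t', B')"] that tB by (simp add: Q_def)
    have BV: "B \<subseteq> V" "B \<inter> T = {t}" "D B = deg E d t" using B(2) by (auto simp: tight_def)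
    have sB: "s \<notin> B" using eqs[OF BV(2)] B(1) by blast
    \<comment> \<open>Two different terminals cannot both have a tight set containing
      \<open>v\<close>: the edge \<open>e\<close> leaves both sets for \<open>s\<close>, so strict
      posimodularity would push one of the differences below its bound.\<close>
    have same: "t' = t" if t': "t' \<noteq> s" "tight t' B'" "v \<in> B'" for t' B'
    proof (rule ccontr)
      assume n: "t' \<noteq> t"
      have B': "B' \<subseteq> V" "B' \<inter> T = {t'}" "D B' = deg E d t'" using t'(2) by (auto simp: tight_def)
      have "s \<notin> B'" using eqs[OF B'(2)] t'(1) by blast
      then have "D (B - B') + D (B' - B) < D B + D B'"
        unfolding D_def
        by (intro cut_posimodular_strict[of E d e v s, OF E(1) c2 e(1)])
           (use e(2) B(3) t'(3) sB in auto)
      moreover have "(B - B') \<inter> T = B \<inter> T - B' \<inter> T" "(B' - B) \<inter> T = B' \<inter> T - B \<inter> T" by blast+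
      then have "(B - B') \<inter> T = {t}" "(B' - B) \<inter> T = {t'}" unfolding BV(2) B'(2) using n by auto
      then have "deg E d t \<le> D (B - B')" "deg E d t' \<le> D (B' - B)"
        by (intro ge; use BV(1) B'(1) in blast)+
      ultimately show False using BV(3) B'(3) by linarith
    qed
    \<comment> \<open>If \<open>v\<close> had no neighbour inside \<open>B\<close>, taking
      \<open>v\<close> out of \<open>B\<close> would add no edge to the cut and lose
      \<open>e\<close>, contradicting tightness.\<close>
    have "\<exists>f w. f \<in> E \<and> d f = {v, w} \<and> w \<in> B - {v}"
    proof (rule ccontr)
      assume no: "\<not> ?thesis"
      have "cut E d (B - {v}) \<subseteq> cut E d B"
      proof
        fix g assume "g \<in> cut E d (B - {v})"
        then have g: "g \<in> E" "d g \<inter> (B - {v}) \<noteq> {}" "\<not> d g \<subseteq> B - {v}" by (auto simp: cut_def)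
        obtain x y where xy: "d g = {x, y}" using c2[OF g(1)] by (meson card_2_iff)
        obtain x y where xy: "d g = {x, y}" "x \<in> B - {v}" "y \<notin> B - {v}"
          using g xy by (metis Diff_iff disjoint_iff insert_commute insert_subset insertE singletonD empty_subsetI)
        have "y \<noteq> v" using no g(1) xy by (metis insert_commute)
        then show "g \<in> cut E d B" using g(1) xy by (auto simp: cut_def)
      qed
      moreover have "e \<in> cut E d B" "e \<notin> cut E d (B - {v})"
        using e sB B(3) by (auto simp: cut_def)
      ultimately have "D (B - {v}) < D B" unfolding D_def
        by (intro psubset_card_mono) (use E(1) in auto)
      moreover have "deg E d t \<le> D (B - {v})" by (rule ge) (use BV sv in blast)+
      ultimately show False using BV(3) by simp
    qed
    then obtain f w where f: "f \<in> E" "d f = {v, w}" "w \<in> B" "w \<noteq> v" by blast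
    have smaller: False if "tight t X" "v \<in> X" "w \<notin> X" "X \<subseteq> B" for X
    proof -
      have "card X < card B" by (rule psubset_card_mono) (use that f(3) fin[OF BV(1)] in auto)
      then show False using min[OF B(1) that(1,2)] by simp
    qed
    have "\<not> (v \<in> X \<and> s \<notin> X \<and> w \<notin> X) \<and> \<not> (v \<notin> X \<and> s \<in> X \<and> w \<in> X)" if X: "tight t' X" for t' X
    proof (intro conjI notI)
      have XV: "X \<subseteq> V" "X \<inter> T = {t'}" "D X = deg E d t'" using X by (auto simp: tight_def)
      {
        \<comment> \<open>Here \<open>B \<inter> X\<close> is a tight set that contains
          \<open>v\<close> but not \<open>w\<close>, against the minimality of
          \<open>B\<close>.\<close>
        assume *: "v \<in> X \<and> s \<notin> X \<and> w \<notin> X"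
        then have "t' = t" using same X neq[OF XV(2)] by blast
        then show False using smaller[OF tight_Int_Un(1)[OF B(2), of X]] X * B(3) by blast
      next
        \<comment> \<open>Here \<open>X\<close> belongs to \<open>s\<close>. Posimodularity makes
          \<open>B - X\<close> tight, and it contains \<open>v\<close> but not \<open>w\<close>,
          again against minimality.\<close>
        assume *: "v \<notin> X \<and> s \<in> X \<and> w \<in> X"
        then have t': "t' = s" using eqs[OF XV(2)] by blast
        have "D (B - X) + D (X - B) \<le> D B + D X"
          unfolding D_def by (rule cut_posimodular[of E d, OF E(1) c2])
        moreover have "(B - X) \<inter> T = B \<inter> T - X \<inter> T" "(X - B) \<inter> T = X \<inter> T - B \<inter> T" by blast+
        then have "(B - X) \<inter> T = {t}" "(X - B) \<inter> T = {t'}" unfolding BV(2) XV(2) using t' B(1) by auto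
        moreover from this have "deg E d t' \<le> D (X - B)" "deg E d t \<le> D (B - X)"
          by (intro ge; use BV(1) XV(1) in blast)+
        moreover have "B - X \<subseteq> V" using BV(1) by blast
        ultimately have "tight t (B - X)"
          using BV(3) XV(3) by (simp add: tight_def)
        then show False using smaller[of "B - X"] * B(3) by blast
      }
    qed
    moreover have "w \<noteq> s" "f \<noteq> e" using f sB e(2) sv(1) by (auto simp: doubleton_eq_iff)
    ultimately show ?thesis using f by blast
  next
    case False
    \<comment> \<open>The set \<open>{s}\<close> witnesses that tight sets of \<open>s\<close>
      avoiding \<open>v\<close> exist, so a largest one can be chosen.\<close>
    have "tight s {s}"
      unfolding tight_def D_def using cut_singleton[of E d s, OF c2] sv e(3) by auto
    moreover have "\<forall>A. tight s A \<and> v \<notin> A \<longrightarrow> card A < Suc (card V)"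
      using V(1) by (auto simp: tight_def less_Suc_eq_le intro: card_mono)
    ultimately obtain A where A: "tight s A" "v \<notin> A"
      and max: "\<And>A'. tight s A' \<Longrightarrow> v \<notin> A' \<Longrightarrow> card A' \<le> card A"
      using ex_has_greatest_nat[of "\<lambda>A. tight s A \<and> v \<notin> A" "{s}" card] sv(1) by blast
    have AV: "A \<subseteq> V" "A \<inter> T = {s}" "D A = deg E d s" using A(1) by (auto simp: tight_def)
    \<comment> \<open>If all neighbours of \<open>v\<close> were in \<open>A\<close>, adding
      \<open>v\<close> to \<open>A\<close> would lose \<open>e\<close> from the cut and gain
      nothing.\<close>
    have "\<exists>f w. f \<in> E \<and> d f = {v, w} \<and> w \<notin> insert v A"
    proof (rule ccontr)
      assume no: "\<not> ?thesis"
      have "cut E d (insert v A) \<subseteq> cut E d A"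
      proof
        fix g assume "g \<in> cut E d (insert v A)"
        then have g: "g \<in> E" "d g \<inter> insert v A \<noteq> {}" "\<not> d g \<subseteq> insert v A" by (auto simp: cut_def)
        obtain x y where xy: "d g = {x, y}" using c2[OF g(1)] by (meson card_2_iff)
        obtain x y where xy: "d g = {x, y}" "x \<in> insert v A" "y \<notin> insert v A"
          using g xy by (metis disjoint_iff insert_commute insert_subset insertE singletonD empty_subsetI)
        have "x \<noteq> v" using no g(1) xy by metis
        then show "g \<in> cut E d A" using g(1) xy by (auto simp: cut_def)
      qed
      moreover have "e \<in> cut E d A" "e \<notin> cut E d (insert v A)"
        using e AV A(2) by (auto simp: cut_def)
      ultimately have "D (insert v A) < D A" unfolding D_def
        by (intro psubset_card_mono) (use E(1) in auto)
      moreover have "deg E d s \<le> D (insert v A)" by (rule ge) (use AV sv in blast)+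
      ultimately show False using AV(3) by simp
    qed
    then obtain f w where f: "f \<in> E" "d f = {v, w}" "w \<notin> A" "w \<noteq> v" by blast
    have "\<not> (v \<in> X \<and> s \<notin> X \<and> w \<notin> X) \<and> \<not> (v \<notin> X \<and> s \<in> X \<and> w \<in> X)" if X: "tight t' X" for t' X
    proof (intro conjI notI)
      have XV: "X \<subseteq> V" "X \<inter> T = {t'}" using X by (auto simp: tight_def)
      {
        assume "v \<in> X \<and> s \<notin> X \<and> w \<notin> X"
        then show False using False X neq[OF XV(2)] by blast
      next
        \<comment> \<open>The union \<open>A \<union> X\<close> is tight, avoids \<open>v\<close>
          and gains \<open>w\<close>, against the maximality of \<open>A\<close>.\<close>
        assume *: "v \<notin> X \<and> s \<in> X \<and> w \<in> X"
        then have "tight s (A \<union> X)" using eqs[OF XV(2)] X tight_Int_Un(2)[OF A(1)] by blast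
        then have "card (A \<union> X) \<le> card A" using max * A(2) by blast
        moreover have "card A < card (A \<union> X)"
          by (rule psubset_card_mono) (use * f(3) fin AV XV in auto)
        ultimately show False by simp
      }
    qed
    moreover have "w \<noteq> s" using f AV by blast
    moreover have "f \<noteq> e" using f e(2) \<open>w \<noteq> s\<close> sv(1) by (auto simp: doubleton_eq_iff)
    ultimately show ?thesis using f by blast
  qed
  then show ?thesis using not_tight unfolding D_def by metis
qed

section \<open>Packing terminal pairs with given multiplicities\<close>

text \<open>The last assumption says that the star of each terminal is a minimum cut separating it
  from the others. An admissible split preserves this and all terminal degrees while removing one
  edge. When no edge joins a terminal to a non-terminal, single edges between terminals already form
  the family.\<close>

lemma lovasz_cherkassky:
  assumes "finite V" "T \<subseteq> V" "finite E" "\<And>g. g \<in> E \<Longrightarrow> d g \<subseteq> V \<and> card (d g) = 2"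
    and "\<And>x. x \<in> V - T \<Longrightarrow> even (deg E d x)"
    and "\<And>X t. X \<subseteq> V \<Longrightarrow> X \<inter> T = {t} \<Longrightarrow> deg E d t \<le> card (cut E d X)"
  shows "\<exists>(I :: 'e set) f. pair_family (E :: 'e set) d T (deg E d) I f"
  using assms(3-)
proof (induction "card E" arbitrary: E d rule: less_induct)
  case (less E d)
  show ?case
  proof (cases "\<exists>e s v. e \<in> E \<and> d e = {s, v} \<and> s \<in> T \<and> v \<in> V - T")
    case False
    define I where "I = {e \<in> E. d e \<inter> T \<noteq> {}}"
    have odd: "odd_verts d {e} = d e" for e using odd_verts_insert[of "{}" e d] by simp
    have "d e \<subseteq> T" if "e \<in> I" for e
    proof -
      have eE: "e \<in> E" using that by (simp add: I_def)
      have "d e \<inter> T \<noteq> {}" using that by (simp add: I_def)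
      then obtain s where s: "s \<in> d e" "s \<in> T" by blast
      obtain a b where "d e = {a, b}" using less.prems(2)[OF eE] by (meson card_2_iff)
      then obtain x where x: "d e = {s, x}" using s(1) by (metis insert_commute insertE singletonD)
      then have "x \<in> V" using less.prems(2)[OF eE] by simp
      then have "x \<in> T" using False eE x s(2) by blast
      then show ?thesis using x s(2) by simp
    qed
    moreover have "{e \<in> I. t \<in> d e} = {e \<in> E. t \<in> d e}" if "t \<in> T" for t using that by (auto simp: I_def)
    ultimately have "pair_family E d T (deg E d) I (\<lambda>e. {e})"
      using less.prems(1,2) by (auto simp: pair_family_def odd deg_def I_def disjoint_family_on_def)
    then show ?thesis by blast
  next
    case True
    then obtain e s v where e: "e \<in> E" "d e = {s, v}" "s \<in> T" "v \<in> V - T" by blast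
    obtain f w where f: "f \<in> E" "f \<noteq> e" "d f = {v, w}" "w \<noteq> s" "w \<noteq> v"
      and adm: "\<And>X t. X \<subseteq> V \<Longrightarrow> X \<inter> T = {t} \<Longrightarrow>
        v \<in> X \<and> s \<notin> X \<and> w \<notin> X \<or> v \<notin> X \<and> s \<in> X \<and> w \<in> X \<Longrightarrow> deg E d t + 2 \<le> card (cut E d X)"
      using exists_admissible_split[of V T E d e s v, OF assms(1,2) less.prems e] by blast
    have dist: "distinct [s, v, w]" using e f by auto
    define E' where "E' = E - {f}"
    define d' where "d' = d(e := {s, w})"
    have fE: "finite E'" "f \<notin> E'" "E' \<subseteq> E" using less.prems(1) by (auto simp: E'_def)
    have ends': "d' g \<subseteq> V \<and> card (d' g) = 2" if "g \<in> E'" for g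
      using that less.prems(2)[of g] less.prems(2)[OF f(1)] less.prems(2)[OF e(1)] e(2) f(3,4)
      by (auto simp: E'_def d'_def)
    have cut': "card (cut E d X) = card (cut E' d' X) +
        (if v \<in> X \<and> s \<notin> X \<and> w \<notin> X \<or> v \<notin> X \<and> s \<in> X \<and> w \<in> X then 2 else 0)" for X
      unfolding E'_def d'_def
      by (rule cut_split_off[of E e f d s v w]) (use less.prems(1) e f dist in auto)
    \<comment> \<open>Degrees are cuts of singletons; among these, the split affects only the cut of
      \<open>{v}\<close>.\<close>
    have deg': "deg E d x = deg E' d' x + (if v = x then 2 else 0)" for x
      using cut'[of "{x}"] cut_singleton[of E d x] cut_singleton[of E' d' x] less.prems(2) ends' dist
      by (auto split: if_splits)
    have degT: "deg E' d' t = deg E d t" if "t \<in> T" for t using deg'[of t] that e(4) by auto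
    have "card E' < card E" unfolding E'_def using less.prems(1) f(1) by (rule card_Diff1_less)
    moreover have "even (deg E' d' x)" if "x \<in> V - T" for x
      using less.prems(3)[OF that] deg'[of x] by (auto split: if_splits)
    moreover have "deg E' d' t \<le> card (cut E' d' X)" if X: "X \<subseteq> V" "X \<inter> T = {t}" for X t
    proof -
      have "t \<in> T" using X(2) by blast
      then have t: "deg E' d' t = deg E d t" by (rule degT)
      show ?thesis
      proof (cases "v \<in> X \<and> s \<notin> X \<and> w \<notin> X \<or> v \<notin> X \<and> s \<in> X \<and> w \<in> X")
        case True
        then show ?thesis using adm[OF X True] cut'[of X] t by simp
      next
        case False
        then have "card (cut E d X) = card (cut E' d' X)" using cut'[of X] by (simp only: if_False add_0_right)
        then show ?thesis using less.prems(4)[OF X] t by simp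
      qed
    qed
    ultimately obtain I :: "'e set" and p where p: "pair_family E' d' T (deg E' d') I p"
      using less.hyps[of E' d'] fE(1) ends' by blast
    \<comment> \<open>Pull the family back by restoring \<open>f\<close> to the member that uses the
      rerouted edge.\<close>
    define q where "q i = (if e \<in> p i then insert f (p i) else p i)" for i
    have pE: "p i \<subseteq> E'" if "i \<in> I" for i using p that by (simp add: pair_family_def)
    have odd: "odd_verts d (q i) = odd_verts d' (p i)" if "i \<in> I" for i
      unfolding q_def d'_def
      by (rule odd_verts_split_off[of "p i" f e d s v w])
         (use pE[OF that] fE f e dist in \<open>auto intro: finite_subset\<close>)
    have cnt: "{i \<in> I. t \<in> odd_verts d (q i)} = {i \<in> I. t \<in> odd_verts d' (p i)}" for t
      using odd by auto
    have "disjoint_family_on q I"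
      unfolding disjoint_family_on_def
    proof (intro ballI impI)
      fix i j assume ij: "i \<in> I" "j \<in> I" "i \<noteq> j"
      then have "p i \<inter> p j = {}" using p by (auto simp: pair_family_def disjoint_family_on_def)
      then show "q i \<inter> q j = {}" using pE[OF ij(1)] pE[OF ij(2)] fE(2) by (auto simp: q_def)
    qed
    moreover have "q i \<subseteq> E" if "i \<in> I" for i using pE[OF that] fE(3) f(1) by (auto simp: q_def)
    ultimately have "pair_family E d T (deg E d) I q"
      using p by (simp add: pair_family_def odd cnt degT)
    then show ?thesis by blast
  qed
qed

text \<open>Prescribed multiplicities reduce to the preceding lemma: hang a new terminal \<open>Inr t\<close> on each
  \<open>t\<close> by \<open>n t\<close> parallel edges.\<close>

lemma exists_pair_family:
  fixes E :: "'e set" and d :: "'e \<Rightarrow> 'v set"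
  assumes V: "finite V" "T \<subseteq> V"
    and E: "finite E" "\<And>g. g \<in> E \<Longrightarrow> d g \<subseteq> V \<and> card (d g) = 2"
    and even: "\<And>x. x \<in> V - T \<Longrightarrow> even (deg E d x)" "\<And>t. t \<in> T \<Longrightarrow> even (deg E d t + n t)"
    and cut_ge: "\<And>X t. X \<subseteq> V \<Longrightarrow> t \<in> X \<inter> T \<Longrightarrow> n t \<le> card (cut E d X) + (\<Sum>r\<in>X \<inter> T - {t}. n r)"
  shows "\<exists>(I :: ('e + 'v \<times> nat) set) f. pair_family E d T n I f"
proof -
  \<comment> \<open>The old terminals \<open>Inl t\<close> turn into ordinary vertices; their new
    degree \<open>deg E d t + n t\<close> is even by assumption.\<close>
  define V' :: "('v + 'v) set" where "V' = Inl ` V \<union> Inr ` T"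
  define T' :: "('v + 'v) set" where "T' = Inr ` T"
  define E' :: "('e + 'v \<times> nat) set" where "E' = Inl ` E \<union> Inr ` (SIGMA t:T. {..<n t})"
  define d' :: "'e + 'v \<times> nat \<Rightarrow> ('v + 'v) set"
    where "d' = case_sum (\<lambda>e. Inl ` d e) (\<lambda>(t, j). {Inl t, Inr t})"
  have finT: "finite T" using V by (rule finite_subset[rotated])
  have fin: "finite V'" "finite E'" using V finT E(1) by (auto simp: V'_def E'_def)
  have d'_Inr: "Inr v \<in> d' e \<longleftrightarrow> (\<exists>j. e = Inr (v, j))" for v e by (cases e) (auto simp: d'_def)
  have d'_Inl: "Inl v \<in> d' e \<longleftrightarrow> (\<exists>g. e = Inl g \<and> v \<in> d g) \<or> (\<exists>j. e = Inr (v, j))" for v e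
    by (cases e) (auto simp: d'_def)
  have deg_Inr: "deg P d' (Inr v) = card {j. Inr (v, j) \<in> P}" if "finite P" for P v
  proof -
    have "{e \<in> P. Inr v \<in> d' e} = (\<lambda>j. Inr (v, j)) ` {j. Inr (v, j) \<in> P}"
      by (auto simp: d'_Inr)
    then show ?thesis by (simp add: deg_def card_image inj_on_def)
  qed
  have deg_Inl: "deg P d' (Inl v) = deg (Inl -` P) d v + card {j. Inr (v, j) \<in> P}"
    if P: "finite P" for P v
  proof -
    have eq: "{e \<in> P. Inl v \<in> d' e} = Inl ` {e \<in> Inl -` P. v \<in> d e} \<union> (\<lambda>j. Inr (v, j)) ` {j. Inr (v, j) \<in> P}"
      by (auto simp: d'_Inl)
    have "finite (Inl ` {e \<in> Inl -` P. v \<in> d e} \<union> (\<lambda>j. Inr (v, j)) ` {j. Inr (v, j) \<in> P})"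
      unfolding eq[symmetric] using P by simp
    then have "deg P d' (Inl v) = card (Inl ` {e \<in> Inl -` P. v \<in> d e} :: ('e + 'v \<times> nat) set) +
        card ((\<lambda>j. Inr (v, j)) ` {j. Inr (v, j) \<in> P} :: ('e + 'v \<times> nat) set)"
      unfolding deg_def eq by (intro card_Un_disjoint) auto
    then show ?thesis by (simp add: deg_def card_image inj_on_def)
  qed
  have pend: "{j. Inr (v, j) \<in> E'} = (if v \<in> T then {..<n v} else {})" for v by (auto simp: E'_def)
  have vim: "Inl -` E' = E" by (auto simp: E'_def)
  have degT: "deg E' d' (Inr t) = n t" if "t \<in> T" for t using deg_Inr[OF fin(2)] pend that by simp
  have "\<exists>(I :: ('e + 'v \<times> nat) set) f. pair_family E' d' T' (deg E' d') I f"
  proof (rule lovasz_cherkassky[OF fin(1) _ fin(2)])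
    show "T' \<subseteq> V'" by (auto simp: T'_def V'_def)
    show "d' g \<subseteq> V' \<and> card (d' g) = 2" if g: "g \<in> E'" for g
    proof (cases g)
      case (Inl e)
      then have "d e \<subseteq> V" "card (d e) = 2" using that E(2)[of e] by (auto simp: E'_def)
      then show ?thesis using Inl by (auto simp: d'_def V'_def card_image)
    next
      case (Inr p)
      then obtain t j where "p = (t, j)" "t \<in> T" using g Inr by (auto simp: E'_def)
      then show ?thesis using Inr V(2) by (auto simp: d'_def V'_def)
    qed
    show "even (deg E' d' x)" if x: "x \<in> V' - T'" for x
    proof -
      obtain v where v: "x = Inl v" "v \<in> V" using x by (auto simp: V'_def T'_def)
      then show ?thesis
        using deg_Inl[OF fin(2), of v] even(1)[of v] even(2)[of v] pend[of v] vim by (cases "v \<in> T") auto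
    qed
    show "deg E' d' t \<le> card (cut E' d' X)" if X: "X \<subseteq> V'" "X \<inter> T' = {t}" for X t
    proof -
      have "t \<in> T'" using X(2) by blast
      then obtain s where s: "t = Inr s" "s \<in> T" by (auto simp: T'_def)
      have inX: "Inr r \<in> X \<longleftrightarrow> r = s" if "r \<in> T" for r
        using X(2) that s(1) unfolding T'_def by blast
      define X0 where "X0 = Inl -` X"
      have X0: "X0 \<subseteq> V" using X(1) by (auto simp: X0_def V'_def)
      have sub: "n s \<le> card (cut E' d' X)"
      \<comment> \<open>If \<open>Inl s\<close> is outside \<open>X\<close>, all \<open>n s\<close>
        pendant edges at \<open>s\<close> are cut. Otherwise the cut contains the original cut edges
        and the pendant edges of every other terminal in \<open>X0\<close>, whose outer ends are
        outside \<open>X\<close>; this is the right-hand side of \<open>cut_ge\<close>.\<close>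
      proof (cases "s \<in> X0")
        case False
        have "Inr ` ({s} \<times> {..<n s}) \<subseteq> cut E' d' X"
          using s(2) inX False by (auto simp: cut_def E'_def d'_def X0_def)
        then have "card (Inr ` ({s} \<times> {..<n s}) :: ('e + 'v \<times> nat) set) \<le> card (cut E' d' X)"
          by (rule card_mono[rotated]) (use fin in simp)
        then show ?thesis by (simp add: card_image)
      next
        case True
        let ?A = "Inl ` cut E d X0 :: ('e + 'v \<times> nat) set"
        let ?B = "Inr ` (SIGMA r:X0 \<inter> T - {s}. {..<n r}) :: ('e + 'v \<times> nat) set"
        have "Inl e \<in> cut E' d' X" if "e \<in> cut E d X0" for e
        proof -
          have "Inl ` d e \<inter> X \<noteq> {}" "\<not> Inl ` d e \<subseteq> X" "e \<in> E"
            using that unfolding cut_def X0_def by blast+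
          then show ?thesis by (simp add: cut_def E'_def d'_def)
        qed
        then have "?A \<subseteq> cut E' d' X" by blast
        moreover have "?B \<subseteq> cut E' d' X"
          using inX by (auto simp: cut_def E'_def d'_def X0_def)
        ultimately have "card (?A \<union> ?B) \<le> card (cut E' d' X)"
          by (intro card_mono) (use fin in auto)
        moreover have "card (?A \<union> ?B) = card ?A + card ?B"
          by (rule card_Un_disjoint) (use E(1) finT in auto)
        moreover have "card ?A + card ?B = card (cut E d X0) + (\<Sum>r\<in>X0 \<inter> T - {s}. n r)"
          using finT by (simp add: card_image)
        ultimately show ?thesis using cut_ge[OF X0, of s] True s(2) by auto
      qed
      then show ?thesis using degT s by simp
    qed
  qed
  then obtain I :: "('e + 'v \<times> nat) set" and f where pf: "pair_family E' d' T' (deg E' d') I f"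
    by blast
  \<comment> \<open>Every \<open>Inl v\<close> has even degree in \<open>f i\<close>, so the
    original edges at \<open>v\<close> have the parity of the pendant edges at \<open>v\<close>,
    which are exactly the edges at \<open>Inr v\<close>.\<close>
  have odd: "odd_verts d' (f i) = Inr ` odd_verts d (Inl -` f i)" if i: "i \<in> I" for i
  proof -
    have "f i \<subseteq> E'" and sub: "odd_verts d' (f i) \<subseteq> T'" using pf i by (auto simp: pair_family_def)
    then have fi: "finite (f i)" using fin(2) by (simp add: finite_subset)
    have nInl: "even (deg (f i) d' (Inl v))" for v using sub by (auto simp: odd_verts_def T'_def)
    then have "odd (deg (f i) d' (Inr v)) \<longleftrightarrow> odd (deg (Inl -` f i) d v)" for v
      using deg_Inl[OF fi, of v] deg_Inr[OF fi, of v] nInl[of v] by simp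
    moreover have "x \<in> range Inr" if "x \<in> odd_verts d' (f i)" for x using sub that by (auto simp: T'_def)
    ultimately show ?thesis unfolding odd_verts_def by blast
  qed
  have "pair_family E d T n I (\<lambda>i. Inl -` f i)"
    unfolding pair_family_def
  proof (intro conjI ballI)
    show "finite I" using pf by (simp add: pair_family_def)
    show "disjoint_family_on (\<lambda>i. Inl -` f i) I" using pf unfolding pair_family_def disjoint_family_on_def by blast
    show "Inl -` f i \<subseteq> E" if "i \<in> I" for i using pf that vim unfolding pair_family_def by blast
    show "odd_verts d (Inl -` f i) \<subseteq> T" if i: "i \<in> I" for i
    proof -
      have "odd_verts d' (f i) \<subseteq> T'" using pf i by (simp add: pair_family_def)
      then show ?thesis unfolding odd[OF i] T'_def by blast
    qed
    show "card (odd_verts d (Inl -` f i)) = 2" if i: "i \<in> I" for i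
    proof -
      have "card (odd_verts d' (f i)) = 2" using pf i by (simp add: pair_family_def)
      then show ?thesis unfolding odd[OF i] by (simp add: card_image)
    qed
    show "card {i \<in> I. t \<in> odd_verts d (Inl -` f i)} = n t" if t: "t \<in> T" for t
    proof -
      have "{i \<in> I. t \<in> odd_verts d (Inl -` f i)} = {i \<in> I. Inr t \<in> odd_verts d' (f i)}" using odd by auto
      then show ?thesis using pf t degT by (simp add: pair_family_def T'_def)
    qed
  qed
  then show ?thesis by blast
qed

section \<open>Packing T-joins for four terminals\<close>

lemma tjoin_packing:
  fixes E :: "'e set" and d :: "'e \<Rightarrow> 'v set"
  assumes V: "finite V" "T \<subseteq> V" and T4: "card T = 4" and k: "k \<ge> 1"
    and E: "finite E" "\<And>g. g \<in> E \<Longrightarrow> d g \<subseteq> V \<and> card (d g) = 2"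
    and even: "\<And>x. x \<in> V - T \<Longrightarrow> even (deg E d x)"
    and cut_ge: "\<And>X t. X \<subseteq> V \<Longrightarrow> X \<inter> T = {t} \<Longrightarrow> k \<le> card (cut E d X)"
  shows "\<exists>J. (\<forall>j\<in>{1..k}. J j \<subseteq> E \<and> odd_verts d (J j) = T) \<and> disjoint_family_on J {1..k}"
proof -
  have c2: "\<And>g. g \<in> E \<Longrightarrow> card (d g) = 2" using E(2) by blast
  have finT: "finite T" using T4 by (simp add: card_ge_0_finite)
  \<comment> \<open>The smallest multiplicities \<open>\<ge> k\<close> with the parity that splitting off requires.\<close>
  define n where "n t = (if even (deg E d t + k) then k else k + 1)" for t
  have n: "n t = k \<or> n t = k + 1" "even (deg E d t + n t)" for t by (auto simp: n_def)
  have hs: "even ((\<Sum>t\<in>X \<inter> T. deg E d t) + card (cut E d X))" if X: "X \<subseteq> V" for X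
  proof -
    have finX: "finite X" using X V(1) by (rule finite_subset)
    have "even (\<Sum>x\<in>X - T. deg E d x)" by (rule dvd_sum) (use even X in blast)
    moreover have "(\<Sum>x\<in>X. deg E d x) = (\<Sum>x\<in>X \<inter> T. deg E d x) + (\<Sum>x\<in>X - T. deg E d x)"
      using finX by (rule sum.Int_Diff)
    ultimately show ?thesis using handshake[of E X d, OF E(1) finX c2] by auto
  qed
  \<comment> \<open>With \<open>t\<close> alone, parity rules out a cut of size \<open>k\<close>
    when \<open>n t = k + 1\<close>. With one further terminal \<open>r\<close>, the only risk is
    \<open>n t = n r + 1\<close>; then the two degrees differ in parity, so the cut is odd and hence
    nonempty. With two further terminals the sum is at least \<open>2 * k\<close>, which is at least
    \<open>k + 1\<close> since \<open>k \<ge> 1\<close>.\<close>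
  have "n t \<le> card (cut E d X) + (\<Sum>r\<in>X \<inter> T - {t}. n r)" if X: "X \<subseteq> V" "t \<in> X \<inter> T" for X t
  proof (cases "X \<inter> T = {t}")
    case True
    then have "even (card (cut E d X) + n t)" using hs[OF X(1)] n(2)[of t] by auto
    then have "card (cut E d X) \<noteq> k \<or> n t \<noteq> k + 1" by auto
    then show ?thesis using cut_ge[OF X(1) True] n(1)[of t] by auto
  next
    case False
    then obtain r where r: "r \<in> X \<inter> T - {t}" using X(2) by blast
    have sum_r: "(\<Sum>r\<in>X \<inter> T - {t}. n r) = n r + (\<Sum>r\<in>X \<inter> T - {t} - {r}. n r)"
      using r finT by (intro sum.remove) auto
    show ?thesis
    proof (cases "X \<inter> T - {t} - {r} = {}")
      case True
      then have "X \<inter> T = {t, r}" "t \<noteq> r" using r X(2) by auto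
      then have "even (deg E d t + deg E d r + card (cut E d X))" using hs[OF X(1)] by simp
      moreover have "n t = n r" if "even (deg E d t + deg E d r)"
        using that unfolding n_def by auto
      ultimately show ?thesis
        using sum_r n(1)[of t] n(1)[of r] by (cases "card (cut E d X) = 0") auto
    next
      case False
      then obtain q where q: "q \<in> X \<inter> T - {t} - {r}" by blast
      then have "n q \<le> (\<Sum>r\<in>X \<inter> T - {t} - {r}. n r)" using finT by (intro member_le_sum) auto
      then show ?thesis using sum_r n(1)[of q] n(1)[of r] n(1)[of t] k by linarith
    qed
  qed
  then have "\<exists>(I :: ('e + 'v \<times> nat) set) f. pair_family E d T n I f"
    by (intro exists_pair_family[of V T E d n] V E even n(2))
  then obtain I :: "('e + 'v \<times> nat) set" and f where pf: "pair_family E d T n I f" by blast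
  \<comment> \<open>The cut of the whole vertex set is empty, so the terminal degrees, and with them
    the multiplicities, have an even sum. Hence \<open>W\<close> has 0, 2 or 4 elements.\<close>
  have "cut E d V = {}" using E(2) by (auto simp: cut_def)
  then have "even (\<Sum>t\<in>T. deg E d t)" using hs[of V] V(2) by (simp add: Int_absorb1)
  moreover have "even (\<Sum>t\<in>T. deg E d t + n t)" by (rule dvd_sum) (use n(2) in blast)
  ultimately have evn: "even (\<Sum>t\<in>T. n t)" by (simp add: sum.distrib)
  define W where "W = {t \<in> T. n t = k + 1}"
  have "(\<Sum>t\<in>T. n t) = (\<Sum>t\<in>T. k + (if n t = k + 1 then 1 else 0))"
    by (rule sum.cong) (use n(1) in auto)
  also have "\<dots> = 4 * k + card W"
    using finT T4 by (simp add: sum.distrib sum.If_cases W_def Int_def)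
  finally have "even (card W)" using evn by simp
  moreover have "card W \<le> 4" using card_mono[of T W] finT T4 by (auto simp: W_def)
  ultimately have "card W = 0 \<or> card W = 2 \<or> card W = 4" by presburger
  then consider "card W = 0" | "card W = 2" | "card W = 4" by (elim disjE)
  then have "\<exists>I m. m \<ge> k \<and> pair_family E d T (\<lambda>_. m) (I :: ('e + 'v \<times> nat) set) f"
  proof cases
    case 1
    then have "W = {}" using finT by (simp add: W_def)
    then have "n t = k" if "t \<in> T" for t using n(1)[of t] that by (auto simp: W_def)
    then have "pair_family E d T (\<lambda>_. k) I f" by (rule pair_family_cong[OF pf])
    then show ?thesis by blast
  next
    case 2
    then obtain c e where ce: "W = {c, e}" "c \<noteq> e" by (meson card_2_iff)
    have "card (T - W) = 2" using 2 T4 finT by (subst card_Diff_subset) (auto simp: W_def)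
    then obtain a b where ab: "T - W = {a, b}" "a \<noteq> b" by (meson card_2_iff)
    have T: "T = {a, b, c, e}" "distinct [a, b, c, e]" using ab ce by (auto simp: W_def)
    have nv: "n a = k" "n b = k" "n c = k + 1" "n e = k + 1"
      using ab ce n(1) unfolding W_def by blast+
    \<comment> \<open>Since \<open>n c + n e = 2 * k + 2\<close> exceeds
      \<open>n a + n b = 2 * k\<close>, some member joins \<open>c\<close> and \<open>e\<close>;
      dropping it makes all multiplicities \<open>k\<close>.\<close>
    obtain i where i: "i \<in> I" "odd_verts d (f i) = {c, e}"
      using pair_family_complementary[of E d a b c e n I f] pf T nv by auto
    have "pair_family E d T (\<lambda>_. k) (I - {i}) f"
      by (rule pair_family_cong[OF pair_family_remove[OF pf i]]) (use T nv in auto)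
    then show ?thesis by blast
  next
    \<comment> \<open>All multiplicities are \<open>k + 1\<close>, which gives one T-join more than
      required; the surplus is discarded at the end.\<close>
    case 3
    then have "W = T" using finT T4 by (intro card_subset_eq) (auto simp: W_def)
    then have "n t = k + 1" if "t \<in> T" for t using that by (auto simp: W_def)
    then have "pair_family E d T (\<lambda>_. k + 1) I f" by (rule pair_family_cong[OF pf])
    then show ?thesis by (metis le_add1)
  qed
  then obtain I' :: "('e + 'v \<times> nat) set" and m
    where m: "m \<ge> k" and pf': "pair_family E d T (\<lambda>_. m) I' f" by blast
  obtain J where J: "\<forall>j\<in>{1..m}. J j \<subseteq> (\<Union>i\<in>I'. f i) \<and> odd_verts d (J j) = T"
    "disjoint_family_on J {1..m}"
    using pair_family_tjoins[OF pf' T4 E(1)] by blast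
  have "(\<Union>i\<in>I'. f i) \<subseteq> E" using pf' by (auto simp: pair_family_def)
  moreover have "{1..k} \<subseteq> {1..m}" using m by auto
  ultimately show ?thesis using J by (meson disjoint_family_on_mono subset_iff subset_trans)
qed

section \<open>From the deletion hypothesis to cuts, and conclusion\<close>

text \<open>With the whole cut deleted, no step of a path can change sides; induct along the
  vertices.\<close>

lemma path_between_delete_cut:
  assumes "path_between (delete_edges G (cut (edges G) (ends G) X)) u v P"
  shows "u \<in> X \<longleftrightarrow> v \<in> X"
proof -
  obtain ws es where P: "P = (ws, es)" by force
  have es: "set es \<subseteq> edges G - cut (edges G) (ends G) X"
    and ends: "{ws ! 0, ws ! length es} = {u, v}"
    and step: "\<And>i. i < length es \<Longrightarrow> ends G (es ! i) = {ws ! i, ws ! Suc i}"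
    using assms by (auto simp: P path_between_def delete_edges_def)
  have "ws ! i \<in> X \<longleftrightarrow> ws ! 0 \<in> X" if "i \<le> length es" for i
    using that
  proof (induction i)
    case (Suc i)
    then have i: "i < length es" by simp
    then have "es ! i \<in> edges G - cut (edges G) (ends G) X" using es nth_mem by blast
    then have "ws ! i \<in> X \<longleftrightarrow> ws ! Suc i \<in> X" using step[OF i] by (auto simp: cut_def)
    then show ?case using Suc by simp
  qed simp
  then have "ws ! length es \<in> X \<longleftrightarrow> ws ! 0 \<in> X" by blast
  then show ?thesis using ends by (auto simp: doubleton_eq_iff)
qed

theorem theorem2p11:
  fixes G :: "('v, 'e) mgraph"
    and k :: nat
    and v1 v2 v3 v4 :: 'v
    and Y :: "'v set"
  assumes "k \<ge> 1"
    and "multigraph G"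
    and "distinct [v1, v2, v3, v4]"
    and "verts G = {v1, v2, v3, v4} \<union> Y"
    and "{v1, v2, v3, v4} \<inter> Y = {}"
    and "\<And>y. y \<in> Y \<Longrightarrow> even (degree G y)"
    and "\<And>F. F \<subseteq> edges G \<Longrightarrow> card F \<le> k - 1 \<Longrightarrow>
           \<exists>a b c d P1 P2.
             splits_into_pairs {v1, v2, v3, v4} a b c d \<and>
             path_between (delete_edges G F) a b P1 \<and>
             path_between (delete_edges G F) c d P2 \<and>
             path_edges P1 \<inter> path_edges P2 = {}"
  shows "\<exists>(a :: nat \<Rightarrow> 'v) (b :: nat \<Rightarrow> 'v) (c :: nat \<Rightarrow> 'v) (d :: nat \<Rightarrow> 'v)
           (P :: nat \<Rightarrow> ('v, 'e) altseq) (Q :: nat \<Rightarrow> ('v, 'e) altseq).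
           (\<forall>j \<in> {1..k}.
              splits_into_pairs {v1, v2, v3, v4} (a j) (b j) (c j) (d j) \<and>
              path_between G (a j) (b j) (P j) \<and>
              path_between G (c j) (d j) (Q j)) \<and>
           (\<forall>i \<in> {1..k}. \<forall>j \<in> {1..k}. i \<noteq> j \<longrightarrow>
              path_edges (P i) \<inter> path_edges (P j) = {} \<and>
              path_edges (Q i) \<inter> path_edges (Q j) = {}) \<and>
           (\<forall>i \<in> {1..k}. \<forall>j \<in> {1..k}. path_edges (P i) \<inter> path_edges (Q j) = {})"
proof -
  interpret multigraph G by fact
  define T where "T = {v1, v2, v3, v4}"
  have T4: "card T = 4" using assms(3) by (simp add: T_def)
  have degree: "degree G v = deg (edges G) (ends G) v" for v by (simp add: degree_def deg_def)
  \<comment> \<open>A cut with fewer than \<open>k\<close> edges could be deleted under the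
    hypothesis. The path at \<open>t\<close> would then join it to another terminal, which lies on
    the other side of the deleted cut.\<close>
  have cut_ge: "k \<le> card (cut (edges G) (ends G) X)" if "X \<inter> T = {t}" for X t
  proof (rule ccontr)
    assume "\<not> ?thesis"
    then have "card (cut (edges G) (ends G) X) \<le> k - 1" by simp
    moreover have "cut (edges G) (ends G) X \<subseteq> edges G" by (auto simp: cut_def)
    ultimately obtain a b c d P1 P2 where s: "splits_into_pairs T a b c d"
      and "path_between (delete_edges G (cut (edges G) (ends G) X)) a b P1"
      "path_between (delete_edges G (cut (edges G) (ends G) X)) c d P2"
      using assms(7)[of "cut (edges G) (ends G) X"] unfolding T_def by blast
    then have iff: "a \<in> X \<longleftrightarrow> b \<in> X" "c \<in> X \<longleftrightarrow> d \<in> X" using path_between_delete_cut by metis+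
    have T: "T = {a, b, c, d}" "distinct [a, b, c, d]" using s by (auto simp: splits_into_pairs_def)
    have inX: "x \<in> X \<longleftrightarrow> x = t" if "x \<in> {a, b, c, d}" for x
      using \<open>X \<inter> T = {t}\<close> that unfolding T(1) by blast
    have "t \<in> {a, b, c, d}" using \<open>X \<inter> T = {t}\<close> unfolding T(1) by blast
    then show False using iff inX[of a] inX[of b] inX[of c] inX[of d] T(2) by auto
  qed
  have "\<exists>J. (\<forall>j\<in>{1..k}. J j \<subseteq> edges G \<and> odd_verts (ends G) (J j) = T) \<and> disjoint_family_on J {1..k}"
  proof (rule tjoin_packing[of "verts G" T k "edges G" "ends G", OF finite_verts _ T4 assms(1) finite_edges])
    show "T \<subseteq> verts G" using assms(4) by (simp add: T_def)
    show "ends G g \<subseteq> verts G \<and> card (ends G g) = 2" if "g \<in> edges G" for g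
      using ends_subset[OF that] card_ends[OF that] by blast
    show "even (deg (edges G) (ends G) x)" if "x \<in> verts G - T" for x
      using that assms(4,6) by (auto simp: T_def degree)
  qed (rule cut_ge)
  then obtain J where J: "\<And>j. j \<in> {1..k} \<Longrightarrow> J j \<subseteq> edges G \<and> odd_verts (ends G) (J j) = T"
    and dJ: "disjoint_family_on J {1..k}" by blast
  have "\<forall>j\<in>{1..k}. \<exists>a b c d P Q. splits_into_pairs T a b c d \<and> path_between G a b P \<and> path_between G c d Q
     \<and> path_edges P \<subseteq> J j \<and> path_edges Q \<subseteq> J j \<and> path_edges P \<inter> path_edges Q = {}"
    using J finite_edges T4 by (intro ballI tjoin_two_paths[OF assms(2)]) (auto intro: finite_subset)
  then obtain a b c d P Q where PQ: "\<And>j. j \<in> {1..k} \<Longrightarrow>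
      splits_into_pairs T (a j) (b j) (c j) (d j) \<and> path_between G (a j) (b j) (P j) \<and>
      path_between G (c j) (d j) (Q j) \<and> path_edges (P j) \<subseteq> J j \<and> path_edges (Q j) \<subseteq> J j \<and>
      path_edges (P j) \<inter> path_edges (Q j) = {}"
    by metis
  have disj: "J i \<inter> J j = {}" if "i \<in> {1..k}" "j \<in> {1..k}" "i \<noteq> j" for i j
    using dJ that by (auto simp: disjoint_family_on_def)
  have paths: "\<forall>j\<in>{1..k}. splits_into_pairs {v1, v2, v3, v4} (a j) (b j) (c j) (d j) \<and>
      path_between G (a j) (b j) (P j) \<and> path_between G (c j) (d j) (Q j)"
    using PQ unfolding T_def by blast
  have same: "\<forall>i\<in>{1..k}. \<forall>j\<in>{1..k}. i \<noteq> j \<longrightarrow>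
      path_edges (P i) \<inter> path_edges (P j) = {} \<and> path_edges (Q i) \<inter> path_edges (Q j) = {}"
  proof (intro ballI impI)
    fix i j assume "i \<in> {1..k}" "j \<in> {1..k}" "i \<noteq> j"
    then show "path_edges (P i) \<inter> path_edges (P j) = {} \<and> path_edges (Q i) \<inter> path_edges (Q j) = {}"
      using disj[of i j] PQ[of i] PQ[of j] by blast
  qed
  have cross: "\<forall>i\<in>{1..k}. \<forall>j\<in>{1..k}. path_edges (P i) \<inter> path_edges (Q j) = {}"
  proof (intro ballI)
    fix i j assume "i \<in> {1..k}" "j \<in> {1..k}"
    then show "path_edges (P i) \<inter> path_edges (Q j) = {}"
      using disj[of i j] PQ[of i] PQ[of j] by (cases "i = j") blast+
  qed
  show ?thesis
    by (intro exI[of _ a] exI[of _ b] exI[of _ c] exI[of _ d] exI[of _ P] exI[of _ Q] conjI paths same cross)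
qed

end
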